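(* Let $E_1$ be the class of all functions $f \in \mathcal{A}(D)$ such that neither of the $2\pi$-periodic functions $u,\tilde{u}:\mathbb{R}\to\mathbb{R}$, $u(\theta)=\operatorname{Re} f(e^{i\theta})$ and $\tilde{u}(\theta)=\operatorname{Im} f(e^{i\theta})$, is differentiable at any point $\theta \in \mathbb{R}$ (i.e. both $u$ and $\tilde u$ are nowhere differentiable). Then $E_1$ is residual in $\mathcal{A}(D)$, i.e. $E_1$ contains a subset of $\mathcal{A}(D)$ which is $G_\delta$ and dense in $\mathcal{A}(D)$.
   Context: $D$ is the open unit disc in $\mathbb{C}$. The disc algebra $\mathcal{A}(D)$ is the set of all holomorphic functions on $D$ which extend continuously to $\overline{D}$, endowed with the supremum norm on $\overline{D}$ (with which it is a complex Banach algebra); each $f\in\mathcal{A}(D)$ is identified with its continuous extension to $\overline{D}$. Differentiability means existence of a finite derivative. *)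

theory Defs
  imports "HOL-Complex_Analysis.Complex_Analysis"
begin

text \<open>Each function of the disc algebra is represented by its continuous extension to the closed
  disc, so that \<^term>\<open>mspace disc_algebra\<close> consists of functions on \<^term>\<open>cball 0 1\<close>
  (in the sense of \<^const>\<open>extensional\<close>); the two lemmas below spell out the space and the metric.\<close>

definition disc_algebra :: "(complex \<Rightarrow> complex) metric" where
  "disc_algebra =
     submetric (cfunspace (top_of_set (cball 0 1)) euclidean_metric) {f. f holomorphic_on ball 0 1}"

lemma mspace_disc_algebra:
  "mspace disc_algebra =
     {f \<in> extensional (cball 0 1). continuous_on (cball 0 1) f \<and> f holomorphic_on ball 0 1}"
proof -
  have bdd: "bounded (f ` cball 0 1)" if "continuous_on (cball 0 1) f" for f :: "complex \<Rightarrow> complex"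
    using compact_continuous_image[OF that compact_cball] by (rule compact_imp_bounded)
  show ?thesis
    unfolding disc_algebra_def mspace_submetric mspace_cfunspace mtopology_of_euclidean
      mspace_euclidean_metric mdist_euclidean_metric mbounded_iff_bounded
      continuous_map_iff_continuous topspace_euclidean_subtopology
    using bdd by blast
qed

lemma mdist_disc_algebra:
  assumes "f \<in> mspace disc_algebra" "g \<in> mspace disc_algebra"
  shows "mdist disc_algebra f g = (SUP z\<in>cball 0 1. norm (f z - g z))"
proof -
  have fspace: "h \<in> Metric_space.fspace UNIV dist (cball 0 1)" if "h \<in> mspace disc_algebra" for h
    using that unfolding disc_algebra_def mspace_submetric mspace_cfunspace Met_TC.fspace_def
      mspace_euclidean_metric mdist_euclidean_metric topspace_euclidean_subtopology
    by blast
  have "cball 0 1 \<noteq> ({} :: complex set)"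
    by simp
  then show ?thesis
    unfolding disc_algebra_def mdist_submetric mdist_cfunspace_eq_mdist_funspace mdist_funspace
      Met_TC.fdist_def mspace_euclidean_metric mdist_euclidean_metric topspace_euclidean_subtopology
    using fspace[OF assms(1)] fspace[OF assms(2)] by (simp only: if_True simp_thms dist_norm)
qed

definition residual_in :: "'a topology \<Rightarrow> 'a set \<Rightarrow> bool" where
  "residual_in X S \<longleftrightarrow>
     S \<subseteq> topspace X \<and> (\<exists>G. G \<subseteq> S \<and> gdelta_in X G \<and> X closure_of G = topspace X)"

definition nowhere_differentiable :: "(real \<Rightarrow> real) \<Rightarrow> bool" where
  "nowhere_differentiable u \<longleftrightarrow> (\<forall>\<theta>. \<not> u differentiable (at \<theta>))"

definition E\<^sub>1 :: "(complex \<Rightarrow> complex) set" where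
  "E\<^sub>1 = {f \<in> mspace disc_algebra.
           nowhere_differentiable (\<lambda>\<theta>. Re (f (cis \<theta>))) \<and>
           nowhere_differentiable (\<lambda>\<theta>. Im (f (cis \<theta>)))}"

end

theory Submission
  imports Defs
begin

text \<open>Baire category. For unimodular \<open>w\<close> let \<open>steep w n\<close> be the set of \<open>f\<close> such that the boundary
  values of \<open>Re (w f)\<close> admit, at every point of the circle, a chord of slope larger than \<open>n\<close>. A
  bounded function with arbitrarily steep chords at a point is not differentiable there, so it suffices
  to intersect over all \<open>n\<close> and over \<open>w = 1\<close> (real part) and \<open>w = -\<i>\<close> (imaginary part). Each
  \<open>steep w n\<close> is open by compactness of the circle. It is dense: replace \<open>f\<close> by a dilation
  \<open>f (r z)\<close>, which is Lipschitz on the closed disc, and add \<open>(e / 2) z^N\<close> with \<open>N\<close> large, which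
  oscillates by \<open>e / 2\<close> within arc distance \<open>pi / (2 N)\<close> of every point.\<close>

section \<open>Metric convergence as uniform convergence, and completeness\<close>

lemma uniform_limit_if_limitin_cfunspace:
  fixes f :: "'a::topological_space \<Rightarrow> 'b::metric_space"
  assumes "limitin (mtopology_of (cfunspace (top_of_set S) euclidean_metric)) \<sigma> f sequentially"
  shows "uniform_limit S \<sigma> f sequentially"
proof (rule uniform_limitI)
  let ?C = "cfunspace (top_of_set S) (euclidean_metric :: 'b metric)"
  interpret C: Metric_space "mspace ?C" "mdist ?C"
    by (rule Metric_space_mspace_mdist)
  fix e :: real
  assume "e > 0"
  then obtain N where N: "\<sigma> n \<in> mspace ?C" "mdist ?C (\<sigma> n) f < e" if "n \<ge> N" for n
    using assms unfolding mtopology_of_def C.limit_metric_sequentially by metis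
  have f: "f \<in> mspace ?C"
    using assms unfolding mtopology_of_def C.limit_metric_sequentially by blast
  have "dist (\<sigma> n x) (f x) < e" if "n \<ge> N" "x \<in> S" for n x
    using mdist_cfunspace_imp_mdist_le[OF N(1)[OF \<open>n \<ge> N\<close>] f order_refl, of x] N(2)[OF \<open>n \<ge> N\<close>] \<open>x \<in> S\<close>
    by simp
  then show "\<forall>\<^sub>F n in sequentially. \<forall>x\<in>S. dist (\<sigma> n x) (f x) < e"
    by (auto simp: eventually_sequentially)
qed

interpretation DA: Metric_space "mspace disc_algebra" "mdist disc_algebra"
  by (rule Metric_space_mspace_mdist)

lemma uniform_limit_if_limitin_disc_algebra:
  assumes "limitin DA.mtopology \<sigma> f sequentially"
  shows "uniform_limit (cball 0 1) \<sigma> f sequentially"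
proof -
  have "limitin (mtopology_of disc_algebra) \<sigma> f sequentially"
    using assms by (simp add: mtopology_of_def)
  then show ?thesis
    unfolding disc_algebra_def mtopology_of_submetric limitin_subtopology
    by (intro uniform_limit_if_limitin_cfunspace) blast
qed

text \<open>Continuous bounded functions into a complete space form a complete space, and the disc
  algebra is closed in it: a uniform limit of functions holomorphic on the open disc is holomorphic
  there. This is what Baire's theorem needs.\<close>

lemma mcomplete_disc_algebra: "DA.mcomplete"
proof -
  let ?C = "cfunspace (top_of_set (cball (0::complex) 1)) (euclidean_metric :: complex metric)"
  interpret C: Metric_space "mspace ?C" "mdist ?C"
    by (rule Metric_space_mspace_mdist)
  interpret S: Submetric "mspace ?C" "mdist ?C" "mspace disc_algebra"
    by unfold_locales (auto simp: disc_algebra_def)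
  have "mcomplete_of ?C"
    unfolding euclidean_metric_def Met_TC.Self_def[symmetric]
    by (rule Met_TC.mcomplete_cfunspace) (simp add: complete_UNIV)
  then have compl: "C.mcomplete"
    by (simp add: mcomplete_of_def)
  have "S.sub.mcomplete"
  proof (rule S.sequentially_closedin_mcomplete_imp_mcomplete[OF compl])
    fix \<sigma> l
    assume \<sigma>: "range \<sigma> \<subseteq> mspace disc_algebra \<and> limitin C.mtopology \<sigma> l sequentially"
    then have "uniform_limit (cball 0 1) \<sigma> l sequentially"
      by (intro uniform_limit_if_limitin_cfunspace) (simp add: mtopology_of_def)
    moreover have "\<forall>\<^sub>F n in sequentially. continuous_on (cball 0 1) (\<sigma> n) \<and> \<sigma> n holomorphic_on ball 0 1"
      using \<sigma> unfolding mspace_disc_algebra by (blast intro: always_eventually)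
    ultimately have "l holomorphic_on ball 0 1"
      using holomorphic_uniform_limit trivial_limit_sequentially by blast
    moreover have "l \<in> mspace ?C"
      using \<sigma> C.limitin_mspace by blast
    ultimately show "l \<in> mspace disc_algebra"
      by (simp add: disc_algebra_def)
  qed
  then show ?thesis
    by (simp add: disc_algebra_def)
qed

section \<open>Openness of the steep sets\<close>

lemma tendsto_diagonal_if_uniform_limit:
  fixes F :: "nat \<Rightarrow> 'a::topological_space \<Rightarrow> 'b::metric_space"
  assumes unif: "uniform_limit S F f sequentially" and "continuous_on S f"
    and "\<And>k. x k \<in> S" "a \<in> S" "x \<longlonglongrightarrow> a"
  shows "(\<lambda>k. F k (x k)) \<longlonglongrightarrow> f a"
proof (rule tendstoI)
  fix e :: real
  assume "e > 0"
  have "(\<lambda>k. f (x k)) \<longlonglongrightarrow> f a"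
    using assms by (intro continuous_on_tendsto_compose[of S f]) auto
  then have "\<forall>\<^sub>F k in sequentially. dist (f (x k)) (f a) < e / 2"
    using \<open>e > 0\<close> tendstoD half_gt_zero by blast
  moreover have "\<forall>\<^sub>F k in sequentially. dist (F k (x k)) (f (x k)) < e / 2"
    using uniform_limitD[OF unif half_gt_zero[OF \<open>e > 0\<close>]] by (rule eventually_mono) (simp add: assms)
  ultimately show "\<forall>\<^sub>F k in sequentially. dist (F k (x k)) (f a) < e"
    by eventually_elim (rule dist_triangle_half_r[of "f (x _)"]; simp add: dist_commute)
qed

text \<open>The strict inequality rules out \<open>h = 0\<close> and makes the negation a family of
  non-strict bounds, which survive limits. No smallness of \<open>h\<close> is imposed: for a
  bounded function, chords of large slope are necessarily short.\<close>

definition steep :: "complex \<Rightarrow> nat \<Rightarrow> (complex \<Rightarrow> complex) set" where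
  "steep w n = {f \<in> mspace disc_algebra.
     \<forall>z\<in>sphere 0 1. \<exists>h. real n * \<bar>h\<bar> < \<bar>Re (w * f (z * cis h)) - Re (w * f z)\<bar>}"

text \<open>The complement is sequentially closed: each of its members has a flat point on the
  circle, where all chords have slope at most \<open>n\<close>. By compactness these points
  accumulate at some \<open>z\<close>, and the bounds pass to the limit function at
  \<open>z\<close>.\<close>

lemma openin_steep: "openin DA.mtopology (steep w n)"
proof -
  let ?K = "mspace disc_algebra - steep w n"
  have "closedin DA.mtopology ?K"
    unfolding DA.metric_closedin_iff_sequentially_closed
  proof (intro conjI allI impI)
    fix \<sigma> f
    assume \<sigma>: "range \<sigma> \<subseteq> ?K \<and> limitin DA.mtopology \<sigma> f sequentially"
    then have f: "f \<in> mspace disc_algebra"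
      using DA.limitin_mspace by blast
    then have contf: "continuous_on (cball 0 1) f"
      by (simp add: mspace_disc_algebra)
    have "\<exists>z\<in>sphere 0 1. \<forall>h. \<bar>Re (w * \<sigma> k (z * cis h)) - Re (w * \<sigma> k z)\<bar> \<le> real n * \<bar>h\<bar>" for k
      using \<sigma> by (force simp: steep_def not_less image_subset_iff)
    then obtain \<zeta> where \<zeta>: "\<And>k. \<zeta> k \<in> sphere 0 1"
      and flat: "\<And>k h. \<bar>Re (w * \<sigma> k (\<zeta> k * cis h)) - Re (w * \<sigma> k (\<zeta> k))\<bar> \<le> real n * \<bar>h\<bar>"
      by metis
    obtain z r where z: "z \<in> sphere 0 1" and r: "strict_mono r" and lim: "(\<zeta> \<circ> r) \<longlonglongrightarrow> z"
      using seq_compactE[OF compact_imp_seq_compact[OF compact_sphere[of 0 1]]] \<zeta> by metis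
    have unif: "uniform_limit (cball 0 1) (\<lambda>k. \<sigma> (r k)) f sequentially"
      using filterlim_compose[OF uniform_limit_if_limitin_disc_algebra filterlim_subseq[OF r]] \<sigma>
      by blast
    \<comment> \<open>Function and base point vary together with \<open>k\<close>, so pointwise
      convergence would not suffice. The case \<open>h = 0\<close> covers the base points
      themselves.\<close>
    have tend: "(\<lambda>k. \<sigma> (r k) (\<zeta> (r k) * cis h)) \<longlonglongrightarrow> f (z * cis h)" for h
    proof (rule tendsto_diagonal_if_uniform_limit[OF unif contf])
      show "(\<lambda>k. \<zeta> (r k) * cis h) \<longlonglongrightarrow> z * cis h"
        using lim by (intro tendsto_intros) (simp add: o_def)
    qed (use \<zeta> z in \<open>auto simp: norm_mult\<close>)
    have "\<bar>Re (w * f (z * cis h)) - Re (w * f z)\<bar> \<le> real n * \<bar>h\<bar>" for h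
    proof (rule tendsto_upperbound)
      show "(\<lambda>k. \<bar>Re (w * \<sigma> (r k) (\<zeta> (r k) * cis h)) - Re (w * \<sigma> (r k) (\<zeta> (r k)))\<bar>) \<longlonglongrightarrow>
          \<bar>Re (w * f (z * cis h)) - Re (w * f z)\<bar>"
        using tend[of h] tend[of 0] by (intro tendsto_intros) auto
    qed (use flat in auto)
    then show "f \<in> ?K"
      using f z unfolding steep_def by (auto simp: not_less simp del: times_complex.sel intro!: bexI[of _ z])
  qed auto
  then have "openin DA.mtopology (mspace disc_algebra - ?K)"
    by (metis DA.topspace_mtopology openin_closedin_eq openin_diff openin_topspace)
  moreover have "mspace disc_algebra - ?K = steep w n"
    by (auto simp: steep_def)
  ultimately show ?thesis
    by simp
qed

section \<open>Density of the steep sets\<close>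

lemma holomorphic_on_imp_Lipschitz:
  assumes "f holomorphic_on S" "open S" "K \<subseteq> S" "compact K" "convex K"
  obtains L where "L \<ge> 0" "\<And>x y. x \<in> K \<Longrightarrow> y \<in> K \<Longrightarrow> norm (f x - f y) \<le> L * norm (x - y)"
proof -
  have "continuous_on K (deriv f)"
    using assms holomorphic_deriv holomorphic_on_imp_continuous_on holomorphic_on_subset by meson
  then have "bounded (deriv f ` K)"
    using compact_continuous_image compact_imp_bounded \<open>compact K\<close> by blast
  then obtain B where B: "\<And>x. x \<in> K \<Longrightarrow> norm (deriv f x) \<le> B" and "B > 0"
    unfolding bounded_pos by (metis imageI)
  have "norm (f x - f y) \<le> B * norm (x - y)" if "x \<in> K" "y \<in> K" for x y
  proof (rule field_differentiable_bound[OF \<open>convex K\<close> _ B that])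
    show "(f has_field_derivative deriv f x) (at x within K)" if "x \<in> K" for x
      using holomorphic_derivI[OF assms(1,2)] that \<open>K \<subseteq> S\<close> by (meson subsetD)
  qed
  then show ?thesis
    using that[of B] \<open>B > 0\<close> by simp
qed

lemma norm_cis_minus_1_le: "norm (cis h - 1) \<le> \<bar>h\<bar>"
  using dist_exp_i_1[of h] abs_sin_x_le_abs_x[of "h / 2"] by (simp add: cis_conv_exp)

lemma cos_oscillation:
  fixes x :: real
  obtains s where "\<bar>s\<bar> = pi / 2" "\<bar>cos (x + s) - cos x\<bar> \<ge> 1"
proof (cases "\<bar>cos (x + pi / 2) - cos x\<bar> \<ge> 1")
  case False
  have "\<bar>cos (x - pi / 2) - cos x\<bar> \<ge> 1"
  proof (rule ccontr)
    assume "\<not> ?thesis"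
    \<comment> \<open>If both quarter-period shifts moved the cosine by less than 1, these two
      squares would sum to less than 2, but their sum is exactly 2.\<close>
    then have "(sin x - cos x)\<^sup>2 < 1" "(sin x + cos x)\<^sup>2 < 1"
      using False by (simp_all add: abs_square_less_1 cos_add cos_diff)
    then show False
      using sin_cos_squared_add[of x] unfolding power2_sum power2_diff by linarith
  qed
  then show ?thesis
    using that[of "- pi / 2"] by simp
next
  case True
  then show ?thesis
    using that[of "pi / 2"] by simp
qed

text \<open>Uniform continuity on the closed ball suffices, since the dilation moves no point of it
  by more than \<open>1 - r\<close>.\<close>

lemma dilation_approx:
  fixes f :: "'a::euclidean_space \<Rightarrow> 'b::metric_space"
  assumes "continuous_on (cball 0 1) f" "e > 0"
  obtains r :: real where "0 < r" "r < 1" "\<And>z. norm z \<le> 1 \<Longrightarrow> dist (f (r *\<^sub>R z)) (f z) < e"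
proof -
  have "uniformly_continuous_on (cball 0 1) f"
    by (intro compact_uniformly_continuous assms compact_cball)
  then obtain d where "d > 0" and d: "\<And>x y. x \<in> cball 0 1 \<Longrightarrow> y \<in> cball 0 1 \<Longrightarrow> dist y x < d \<Longrightarrow> dist (f y) (f x) < e"
    using \<open>e > 0\<close> unfolding uniformly_continuous_on_def by blast
  \<comment> \<open>The bound 1/2 keeps \<open>r\<close> positive when \<open>d\<close> is
    large.\<close>
  define r where "r = max (1 / 2) (1 - d / 2)"
  have r: "0 < r" "r < 1" "1 - r < d"
    using \<open>d > 0\<close> by (auto simp: r_def)
  have "dist (f (r *\<^sub>R z)) (f z) < e" if "norm z \<le> 1" for z
  proof (rule d)
    have "dist (r *\<^sub>R z) z = (1 - r) * norm z"
      using r norm_scaleR[of "r - 1" z] by (simp add: dist_norm algebra_simps)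
    also have "\<dots> < d"
      using r mult_left_le[OF that, of "1 - r"] by linarith
    finally show "dist (r *\<^sub>R z) z < d" .
  qed (use r that in \<open>auto simp: mult_le_one\<close>)
  with r that show ?thesis
    by blast
qed

lemma steep_dense:
  assumes w: "norm w = 1"
  shows "DA.mtopology closure_of steep w n = mspace disc_algebra"
proof -
  have "\<exists>g\<in>steep w n. g \<in> DA.mball f e" if f: "f \<in> mspace disc_algebra" and "e > 0" for f e
  proof -
    have contf: "continuous_on (cball 0 1) f" and holf: "f holomorphic_on ball 0 1"
      using f by (auto simp: mspace_disc_algebra)
    obtain r :: real where r: "0 < r" "r < 1"
      and approx: "\<And>z. norm z \<le> 1 \<Longrightarrow> dist (f (r *\<^sub>R z)) (f z) < e / 4"
      using dilation_approx[OF contf, of "e / 4"] \<open>e > 0\<close> by auto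
    define F where "F z = f (of_real r * z)" for z
    \<comment> \<open>Dilating gains room: the closed unit disc is now a compact subset of the
      domain of holomorphy, so \<open>F\<close> is Lipschitz on it.\<close>
    have holF: "F holomorphic_on ball 0 (1 / r)"
      unfolding F_def
      by (rule holomorphic_on_compose_gen[OF _ holf, unfolded o_def])
        (use r in \<open>auto intro!: holomorphic_intros simp: norm_mult field_simps\<close>)
    have sub: "cball 0 1 \<subseteq> ball (0::complex) (1 / r)"
      using r by (force simp: field_simps intro: le_less_trans[OF mult_left_le])
    obtain L where "L \<ge> 0" and L: "\<And>x y. x \<in> cball 0 1 \<Longrightarrow> y \<in> cball 0 1 \<Longrightarrow> norm (F x - F y) \<le> L * norm (x - y)"
      using holomorphic_on_imp_Lipschitz[OF holF open_ball sub compact_cball convex_cball] by blast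
    \<comment> \<open>Chosen so that \<open>(n + L) * \<bar>h\<bar> < e / 2\<close> for the step
      length \<open>pi / (2 * N)\<close> used below.\<close>
    obtain N where N: "real N > (n + L) * pi / e"
      using reals_Archimedean2 by blast
    moreover have "(n + L) * pi / e \<ge> 0"
      using \<open>L \<ge> 0\<close> \<open>e > 0\<close> by simp
    ultimately have "N > 0"
      by linarith
    define G where "G z = F z + of_real (e / 2) * z ^ N" for z
    \<comment> \<open>The restriction makes the function extensional, as membership in the space
      requires.\<close>
    define g where "g = restrict G (cball 0 1)"
    have "G holomorphic_on ball 0 (1 / r)"
      unfolding G_def by (intro holomorphic_intros holF)
    then have "G holomorphic_on cball 0 1"
      using sub holomorphic_on_subset by blast
    then have "continuous_on (cball 0 1) G" "G holomorphic_on ball 0 1"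
      using holomorphic_on_imp_continuous_on holomorphic_on_subset ball_subset_cball by blast+
    then have g: "g \<in> mspace disc_algebra"
      unfolding mspace_disc_algebra g_def
      using continuous_on_eq[of "cball 0 1" G g] holomorphic_transform[of G "ball 0 1" g]
      by (simp add: g_def)
    \<comment> \<open>The dilation costs \<open>e / 4\<close> and the added monomial
      \<open>e / 2\<close>, in total less than \<open>e\<close>.\<close>
    have "mdist disc_algebra f g \<le> e / 4 + e / 2"
      unfolding mdist_disc_algebra[OF f g]
    proof (rule cSUP_least)
      fix z :: complex
      assume z: "z \<in> cball 0 1"
      have "norm (f z - F z) \<le> e / 4"
        using approx[of z] z by (simp add: F_def dist_norm norm_minus_commute scaleR_conv_of_real)
      moreover have "norm (of_real (e / 2) * z ^ N) \<le> e / 2"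
        using z \<open>e > 0\<close> by (simp add: norm_mult norm_power power_le_one mult_left_le)
      ultimately show "norm (f z - g z) \<le> e / 4 + e / 2"
        using z norm_triangle_le_diff[of "f z - F z" "of_real (e / 2) * z ^ N" "e / 4 + e / 2"]
        by (simp add: g_def G_def algebra_simps)
    qed simp
    moreover have "\<exists>h::real. n * \<bar>h\<bar> < \<bar>Re (w * g (z * cis h)) - Re (w * g z)\<bar>" if z: "z \<in> sphere 0 1" for z
    proof -
      define \<phi> \<theta> where "\<phi> = Arg w" and "\<theta> = Arg z"
      have "w \<noteq> 0" "z \<noteq> 0"
        using w z by auto
      then have \<phi>: "w = cis \<phi>" and \<theta>: "z = cis \<theta>"
        using w z by (simp_all add: \<phi>_def \<theta>_def cis_Arg sgn_div_norm)
      obtain s where s: "\<bar>s\<bar> = pi / 2" "\<bar>cos (\<phi> + N * \<theta> + s) - cos (\<phi> + N * \<theta>)\<bar> \<ge> 1"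
        by (rule cos_oscillation)
      \<comment> \<open>Moving the angle by \<open>s / N\<close> shifts the phase of the
        \<open>N\<close>-th power by exactly \<open>s\<close>.\<close>
      define h where "h = s / N"
      have h: "\<bar>h\<bar> = pi / (2 * N)"
        unfolding h_def abs_divide s(1) by simp
      have zh: "z * cis h \<in> cball 0 1" "z \<in> cball 0 1"
        using z by (auto simp: norm_mult)
      have wave: "Re (w * (of_real (e / 2) * cis t ^ N)) = e / 2 * cos (\<phi> + N * t)" for t :: real
      proof -
        have *: "w * (of_real (e / 2) * cis t ^ N) = of_real (e / 2) * cis (\<phi> + N * t)"
          by (simp only: \<phi> Complex.DeMoivre cis_mult mult.left_commute[of "cis \<phi>"])
        show ?thesis
          unfolding * by simp
      qed
      have "\<bar>Re (w * (F (z * cis h) - F z))\<bar> \<le> norm (F (z * cis h) - F z)"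
        using abs_Re_le_cmod[of "w * (F (z * cis h) - F z)"] w by (simp add: norm_mult)
      also have "\<dots> \<le> L * norm (z * (cis h - 1))"
        using L[OF zh] by (simp add: algebra_simps)
      also have "\<dots> \<le> L * \<bar>h\<bar>"
        using z \<open>L \<ge> 0\<close> norm_cis_minus_1_le by (simp add: norm_mult mult_left_mono)
      finally have "\<bar>Re (w * (F (z * cis h) - F z))\<bar> \<le> L * \<bar>h\<bar>" .
      moreover have "e / 2 \<le> \<bar>e / 2 * cos (\<phi> + N * (\<theta> + h)) - e / 2 * cos (\<phi> + N * \<theta>)\<bar>"
        using s(2) \<open>e > 0\<close> \<open>N > 0\<close> unfolding right_diff_distrib[symmetric] abs_mult
        by (simp add: h_def algebra_simps)
      moreover have "(n + L) * \<bar>h\<bar> < e / 2"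
        using N \<open>N > 0\<close> \<open>e > 0\<close> unfolding h by (simp add: field_simps)
      moreover have "Re (w * g (z * cis h)) - Re (w * g z) = Re (w * (F (z * cis h) - F z))
          + (e / 2 * cos (\<phi> + N * (\<theta> + h)) - e / 2 * cos (\<phi> + N * \<theta>))"
        using zh unfolding wave[symmetric] by (simp add: g_def G_def \<theta> cis_mult ring_distribs)
      \<comment> \<open>The wave changes by at least \<open>e / 2\<close>, hence by more than
        \<open>(n + L) * \<bar>h\<bar>\<close>; the Lipschitz part can cancel at most
        \<open>L * \<bar>h\<bar>\<close> of this.\<close>
      ultimately have "n * \<bar>h\<bar> < \<bar>Re (w * g (z * cis h)) - Re (w * g z)\<bar>"
        unfolding distrib_right by linarith
      then show ?thesis ..
    qed
    ultimately show ?thesis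
      using f g \<open>e > 0\<close> unfolding steep_def DA.in_mball by (intro bexI[of _ g]) auto
  qed
  then show ?thesis
    unfolding DA.metric_closure_of by blast
qed

section \<open>From steep chords to nowhere differentiability, and the Baire argument\<close>

lemma nowhere_differentiable_if_steep:
  assumes steep: "\<And>n. f \<in> steep w n"
  shows "nowhere_differentiable (\<lambda>\<theta>. Re (w * f (cis \<theta>)))"
  unfolding nowhere_differentiable_def
proof (intro allI notI)
  fix \<theta>
  define u where "u \<theta> = Re (w * f (cis \<theta>))" for \<theta>
  assume "(\<lambda>\<theta>. Re (w * f (cis \<theta>))) differentiable (at \<theta>)"
  then have "u differentiable (at \<theta>)"
    by (simp add: u_def[abs_def])
  then obtain D where "(u has_real_derivative D) (at \<theta>)"
    using real_differentiable_def by blast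
  then have "(\<lambda>h. (u (\<theta> + h) - u \<theta>) / h) \<midarrow>0\<rightarrow> D"
    by (simp add: DERIV_def)
  from tendstoD[OF this zero_less_one] obtain d where "d > 0"
    and d: "\<And>h. h \<noteq> 0 \<Longrightarrow> \<bar>h\<bar> < d \<Longrightarrow> \<bar>(u (\<theta> + h) - u \<theta>) / h - D\<bar> < 1"
    unfolding eventually_at by (auto simp: dist_real_def)
  have "continuous_on (cball 0 1) f"
    using steep by (auto simp: steep_def mspace_disc_algebra)
  then have "bounded (f ` cball 0 1)"
    using compact_continuous_image compact_imp_bounded compact_cball by blast
  then obtain B where B: "\<And>z. norm z \<le> 1 \<Longrightarrow> norm (f z) \<le> B"
    unfolding bounded_iff by (metis imageI mem_cball_0)
  have u: "\<bar>u t\<bar> \<le> norm w * B" for t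
    using abs_Re_le_cmod[of "w * f (cis t)"] mult_left_mono[OF B[of "cis t"], of "norm w"]
    by (simp add: u_def norm_mult)
  \<comment> \<open>The first bound excludes steep chords shorter than \<open>d\<close>, whose
    slopes stay below \<open>\<bar>D\<bar> + 1\<close>. The second excludes the longer ones, since
    \<open>u\<close> varies by at most \<open>2 * (norm w * B)\<close>.\<close>
  obtain n :: nat where n: "real n \<ge> max (\<bar>D\<bar> + 1) (2 * (norm w * B) / d)"
    using real_arch_simple by blast
  have "\<exists>h::real. n * \<bar>h\<bar> < \<bar>u (\<theta> + h) - u \<theta>\<bar>"
    using steep[of n] unfolding steep_def u_def cis_mult[symmetric] by (auto simp del: times_complex.sel)
  then obtain h :: real where h: "n * \<bar>h\<bar> < \<bar>u (\<theta> + h) - u \<theta>\<bar>" ..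
  then have "h \<noteq> 0"
    by auto
  show False
  proof (cases "\<bar>h\<bar> < d")
    case True
    then have "\<bar>(u (\<theta> + h) - u \<theta>) / h\<bar> \<le> n"
      using d[OF \<open>h \<noteq> 0\<close>] n by linarith
    then show False
      using h \<open>h \<noteq> 0\<close> by (simp add: abs_divide field_simps)
  next
    case False
    have "2 * (norm w * B) \<le> n * d"
      using n \<open>d > 0\<close> by (simp add: field_simps)
    also have "\<dots> \<le> n * \<bar>h\<bar>"
      using False by (simp add: mult_left_mono)
    finally show False
      using h u[of "\<theta> + h"] u[of \<theta>] by linarith
  qed
qed

theorem corollary2p7:
  shows "residual_in (mtopology_of disc_algebra) E\<^sub>1"
proof -
  define \<G> where "\<G> = (\<lambda>(w, n). steep w n) ` ({1, -\<i>} \<times> UNIV)"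
  have "countable \<G>" "\<G> \<noteq> {}"
    by (auto simp: \<G>_def)
  have top: "openin DA.mtopology T \<and> DA.mtopology closure_of T = mspace disc_algebra" if "T \<in> \<G>" for T
    using that openin_steep steep_dense by (auto simp: \<G>_def)
  have "f \<in> E\<^sub>1" if "f \<in> \<Inter>\<G>" for f
  proof -
    have 1: "f \<in> steep 1 n" and i: "f \<in> steep (-\<i>) n" for n
      using that by (auto simp: \<G>_def)
    show ?thesis
      using 1 nowhere_differentiable_if_steep[OF 1] nowhere_differentiable_if_steep[OF i]
      by (simp add: E\<^sub>1_def steep_def)
  qed
  moreover have "gdelta_in DA.mtopology (\<Inter>\<G>)"
    using top \<open>countable \<G>\<close> \<open>\<G> \<noteq> {}\<close> by (simp add: gdelta_in_Inter open_imp_gdelta_in)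
  \<comment> \<open>Completeness enters here: a countable intersection of dense open sets remains
    dense.\<close>
  moreover have "DA.mtopology closure_of \<Inter>\<G> = mspace disc_algebra"
    using DA.metric_Baire_category[OF mcomplete_disc_algebra \<open>countable \<G>\<close>] top by blast
  moreover have "E\<^sub>1 \<subseteq> mspace disc_algebra"
    by (auto simp: E\<^sub>1_def)
  ultimately show ?thesis
    unfolding residual_in_def mtopology_of_def by (auto intro!: exI[of _ "\<Inter>\<G>"])
qed

end
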